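(* Let $K$ be a compact Hausdorff space. For every positive linear functional $\xi$ on $\mathcal{C}(K)$ there is a Baire measure $\mu$ on $K$ such that $\xi(f)=\int f\,d\mu$ for every $f\in\mathcal{C}(K)$.
   Context: $\mathcal{C}(K)$ is the space of continuous real-valued functions on $K$ with the pointwise order. A linear functional $\xi$ on $\mathcal{C}(K)$ is positive if $\xi(f)\ge 0$ whenever $f\ge 0$. The Baire $\sigma$-algebra $\mathcal{B}_K$ of $K$ is the smallest $\sigma$-algebra of subsets of $K$ which makes every $f\in\mathcal{C}(K)$ measurable. A Baire measure on $K$ is a finite (nonnegative, countably additive) measure on $\mathcal{B}_K$. *)

theory Defs
  imports "HOL-Analysis.Analysis"
begin

(* A space K is an abstract topology, its points being topspace K.  The functions in
   \<C>(K) are normalised to be undefined off topspace K (extensional), so that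
   elements of cfun K are exactly the continuous functions on K. *)
definition cfun :: "'a topology \<Rightarrow> ('a \<Rightarrow> real) set" where
  "cfun K = {f \<in> extensional (topspace K). continuous_map K euclideanreal f}"

(* Values of \<xi> outside cfun K are irrelevant. *)
definition linear_functional :: "'a topology \<Rightarrow> (('a \<Rightarrow> real) \<Rightarrow> real) \<Rightarrow> bool" where
  "linear_functional K \<xi> \<longleftrightarrow>
     (\<forall>f\<in>cfun K. \<forall>g\<in>cfun K. \<xi> (\<lambda>x\<in>topspace K. f x + g x) = \<xi> f + \<xi> g) \<and>
     (\<forall>c. \<forall>f\<in>cfun K. \<xi> (\<lambda>x\<in>topspace K. c * f x) = c * \<xi> f)"

definition positive_functional :: "'a topology \<Rightarrow> (('a \<Rightarrow> real) \<Rightarrow> real) \<Rightarrow> bool" where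
  "positive_functional K \<xi> \<longleftrightarrow>
     (\<forall>f\<in>cfun K. (\<forall>x\<in>topspace K. 0 \<le> f x) \<longrightarrow> 0 \<le> \<xi> f)"

definition baire_sets :: "'a topology \<Rightarrow> 'a set set" where
  "baire_sets K =
     sigma_sets (topspace K) {f -` B \<inter> topspace K | f B. f \<in> cfun K \<and> B \<in> sets borel}"

lemma sigma_algebra_baire_sets: "sigma_algebra (topspace K) (baire_sets K)"
  unfolding baire_sets_def by (rule sigma_algebra_sigma_sets) blast

lemma cfun_baire_measurable:
  assumes "space M = topspace K" "sets M = baire_sets K" "f \<in> cfun K"
  shows "f \<in> borel_measurable M"
proof (rule measurableI)
  fix B :: "real set" assume "B \<in> sets borel"
  then have "f -` B \<inter> topspace K \<in> baire_sets K"
    unfolding baire_sets_def using assms(3) by (intro sigma_sets.Basic) blast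
  then show "f -` B \<inter> space M \<in> sets M"
    using assms by simp
qed simp

lemma baire_sets_least:
  assumes "space M = topspace K" "\<And>f. f \<in> cfun K \<Longrightarrow> f \<in> borel_measurable M"
  shows "baire_sets K \<subseteq> sets M"
proof -
  have "{f -` B \<inter> topspace K | f B. f \<in> cfun K \<and> B \<in> sets borel} \<subseteq> sets M"
    using assms by (auto simp flip: assms(1) intro: measurable_sets)
  then show ?thesis
    unfolding baire_sets_def assms(1)[symmetric] by (rule sets.sigma_sets_subset)
qed

definition baire_measure :: "'a topology \<Rightarrow> 'a measure \<Rightarrow> bool" where
  "baire_measure K \<mu> \<longleftrightarrow>
     space \<mu> = topspace K \<and> sets \<mu> = baire_sets K \<and> finite_measure \<mu>"

(* The Bochner integral is 0 by convention for non-integrable functions; this never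
   happens for continuous functions on a compact space and a Baire measure. *)
lemma cfun_integrable:
  assumes "compact_space K" "baire_measure K \<mu>" "f \<in> cfun K"
  shows "integrable \<mu> f"
proof -
  interpret finite_measure \<mu> using assms(2) by (simp add: baire_measure_def)
  have "compactin euclideanreal (f ` topspace K)"
    using assms(1,3) image_compactin by (fastforce simp: cfun_def compact_space_def)
  then have "bounded (f ` topspace K)"
    by (simp add: compact_imp_bounded)
  then obtain B where B: "\<And>x. x \<in> topspace K \<Longrightarrow> norm (f x) \<le> B"
    by (auto simp: bounded_iff)
  show ?thesis
    by (rule integrable_const_bound[of _ B])
      (use assms B in \<open>auto simp: baire_measure_def intro: cfun_baire_measurable\<close>)
qed

end

theory Submission
  imports Defs
begin

text \<open>
  The measure is not built on the points of \<open>K\<close> but one dimension higher, where \<open>\<xi>\<close> itself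
  prescribes a volume: the region \<open>{(x, t). f x < t \<le> g x}\<close> between two continuous functions
  \<open>f \<le> g\<close> should have measure \<open>\<xi> (g - f)\<close>.  These regions form a semiring
  (\<open>semiring_strips\<close>), and the volume is a single value of \<open>\<xi>\<close>, whereas the measure of a subset
  of \<open>K\<close> would have to be approximated.  It is countably additive (\<open>countably_additive_strips\<close>): over each
  point the lengths of the fibres add up, because Lebesgue measure is countably additive, so the
  partial sums are continuous functions increasing pointwise to a continuous function.  By
  Dini's argument the convergence is uniform on the compact space \<open>K\<close>, hence preserved by \<open>\<xi>\<close>
  (\<open>sums\<close>).  Caratheodory's theorem extends the volume to a measure \<open>\<nu>\<close>.

  Slicing at height one gives \<open>\<mu> A = \<nu> (A \<times> {0<..1})\<close>.  This makes sense on Baire sets since the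
  cylinder over a superlevel set \<open>{x. c < f x}\<close> is a countable union of strips
  (\<open>superlevel_cylinder\<close>).  Monotonicity of \<open>\<nu>\<close> alone shows that \<open>\<mu>\<close> and \<open>\<xi>\<close> compare correctly:
  \<open>0 \<le> g \<le> 1\<^sub>A\<close> implies \<open>\<xi> g \<le> \<mu> A\<close>, and \<open>1\<^sub>A \<le> g\<close> implies \<open>\<mu> A \<le> \<xi> g\<close> (\<open>baire_measure_exists\<close>).

  These comparisons determine \<open>\<xi>\<close>.  For \<open>0 \<le> g \<le> 1\<close> both \<open>\<xi> g\<close> and \<open>\<integral>g d\<mu>\<close> lie between \<open>\<mu> {g = 1}\<close>
  and \<open>\<mu> {0 < g}\<close>, so they differ by at most \<open>\<mu> {0 < g < 1}\<close>.  If \<open>0 \<le> f \<le> 1\<close>, then \<open>n f\<close> is the sum of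
  its \<open>n\<close> unit layers, the ramps \<open>max 0 (min 1 (n f - k))\<close>; the sets on which the ramps lie
  strictly between 0 and 1 are disjoint, so \<open>n |\<integral>f d\<mu> - \<xi> f| \<le> \<mu> K\<close> for every \<open>n\<close>, and the
  difference vanishes (\<open>baire_representation\<close>).
\<close>

section \<open>Positive functionals and monotone limits\<close>

text \<open>
  The functional is taken on all functions that are continuous on \<open>K\<close>, whatever their values off
  \<open>K\<close>, so that sums, maxima and the like can be formed without restricting them to \<open>topspace K\<close>.
  Linearity and positivity force such a functional to ignore the values off \<open>K\<close> (\<open>cong\<close>).
\<close>

locale positive_linear_functional =
  fixes K :: "'a topology" and I :: "('a \<Rightarrow> real) \<Rightarrow> real"
  assumes compact: "compact_space K"
    and add: "\<And>f g. continuous_map K euclideanreal f \<Longrightarrow> continuous_map K euclideanreal g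
      \<Longrightarrow> I (\<lambda>x. f x + g x) = I f + I g"
    and cmult: "\<And>c f. continuous_map K euclideanreal f \<Longrightarrow> I (\<lambda>x. c * f x) = c * I f"
    and nonneg: "\<And>f. continuous_map K euclideanreal f \<Longrightarrow> (\<And>x. x \<in> topspace K \<Longrightarrow> 0 \<le> f x)
      \<Longrightarrow> 0 \<le> I f"
begin

lemma diff:
  assumes "continuous_map K euclideanreal f" "continuous_map K euclideanreal g"
  shows "I (\<lambda>x. f x - g x) = I f - I g"
  using add[OF assms(1) continuous_map_real_mult_left[OF assms(2), of "-1"]] cmult[OF assms(2), of "-1"]
  by simp

lemma mono:
  assumes "continuous_map K euclideanreal f" "continuous_map K euclideanreal g"
    and "\<And>x. x \<in> topspace K \<Longrightarrow> f x \<le> g x"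
  shows "I f \<le> I g"
  using nonneg[of "\<lambda>x. g x - f x"] diff[OF assms(2,1)] assms
  by (simp add: continuous_map_diff)

lemma continuous_cong:
  assumes "continuous_map K euclideanreal f" "\<And>x. x \<in> topspace K \<Longrightarrow> f x = g x"
  shows "continuous_map K euclideanreal g"
  using continuous_map_eq[OF assms] .

lemma cong:
  assumes "continuous_map K euclideanreal f" "\<And>x. x \<in> topspace K \<Longrightarrow> f x = g x"
  shows "I f = I g"
  using mono[of f g] mono[of g f] continuous_cong[OF assms] assms by (simp add: antisym)

lemma zero: "I (\<lambda>x. 0) = 0"
  using cmult[of "\<lambda>x. 0" 0] by simp

lemma sum:
  assumes "finite S" "\<And>i. i \<in> S \<Longrightarrow> continuous_map K euclideanreal (f i)"
  shows "I (\<lambda>x. \<Sum>i\<in>S. f i x) = (\<Sum>i\<in>S. I (f i))"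
  using assms
proof (induction S rule: finite_induct)
  case (insert i S)
  then show ?case
    using add[of "f i" "\<lambda>x. \<Sum>i\<in>S. f i x"] continuous_map_sum[of S K "\<lambda>x i. f i x"] by simp
qed (simp add: zero)

text \<open>
  Dini's argument: for \<open>e > 0\<close> the open sets \<open>{x. u n x < e}\<close> cover \<open>K\<close> and increase with \<open>n\<close>, so one
  of them is all of \<open>K\<close>, and from then on \<open>I (u n) \<le> e * I 1\<close>.
\<close>
lemma tendsto_zero_of_decreasing:
  fixes u :: "nat \<Rightarrow> 'a \<Rightarrow> real"
  assumes cont: "\<And>n. continuous_map K euclideanreal (u n)"
    and dec: "\<And>x. x \<in> topspace K \<Longrightarrow> decseq (\<lambda>n. u n x)"
    and lim: "\<And>x. x \<in> topspace K \<Longrightarrow> (\<lambda>n. u n x) \<longlonglongrightarrow> 0"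
  shows "(\<lambda>n. I (u n)) \<longlonglongrightarrow> 0"
proof (rule LIMSEQ_I)
  fix r :: real assume "0 < r"
  have I1: "0 \<le> I (\<lambda>x. 1)" by (rule nonneg) simp_all
  \<comment> \<open>The summand 1 in the denominator covers the case that \<open>I\<close> vanishes on constants.\<close>
  define e where "e = r / (I (\<lambda>x. 1) + 1)"
  have e: "0 < e" "e * I (\<lambda>x. 1) < r"
    using \<open>0 < r\<close> I1 by (simp_all add: e_def field_simps)
  define U where "U n = {x \<in> topspace K. u n x \<in> {..<e}}" for n
  have "openin K (U n)" for n
    unfolding U_def by (rule openin_continuous_map_preimage[OF cont]) (simp flip: open_openin)
  moreover have "topspace K \<subseteq> \<Union>(range U)"
  proof
    fix x assume x: "x \<in> topspace K"
    then have "\<forall>\<^sub>F n in sequentially. u n x < e"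
      using order_tendstoD(2)[OF lim e(1)] by blast
    then show "x \<in> \<Union>(range U)"
      using x by (auto simp: U_def eventually_sequentially)
  qed
  ultimately obtain F where "finite F" "F \<subseteq> range U" "topspace K \<subseteq> \<Union>F"
    using compact unfolding compact_space_alt by (metis (no_types, lifting) imageE)
  then obtain J where J: "finite J" "topspace K \<subseteq> \<Union>(U ` J)"
    by (metis finite_subset_image)
  \<comment> \<open>Inserting 0 makes the maximum meaningful when \<open>K\<close>, and with it possibly \<open>J\<close>, is empty.\<close>
  have small: "u n x \<le> e" if n: "Max (insert 0 J) \<le> n" and x: "x \<in> topspace K" for n x
  proof -
    obtain j where "j \<in> J" "u j x < e" using J(2) x by (auto simp: U_def)
    moreover have "j \<le> n"
      using n J(1) \<open>j \<in> J\<close> by simp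
    ultimately show ?thesis
      using decseqD[OF dec[OF x], of j n] by linarith
  qed
  have nn: "0 \<le> u n x" if "x \<in> topspace K" for n x
    using decseq_ge[OF dec[OF that] lim[OF that]] .
  have "norm (I (u n) - 0) < r" if "Max (insert 0 J) \<le> n" for n
  proof -
    have "I (u n) \<le> I (\<lambda>x. e * 1)"
      using small[OF that] by (intro mono cont) simp_all
    also have "\<dots> < r"
      using e(2) cmult[of "\<lambda>x. 1" e] by simp
    finally show ?thesis
      using nonneg[OF cont nn] by simp
  qed
  then show "\<exists>no. \<forall>n\<ge>no. norm (I (u n) - 0) < r" by blast
qed

lemma sums:
  assumes cont: "\<And>n. continuous_map K euclideanreal (h n)" "continuous_map K euclideanreal s"
    and pos: "\<And>n x. x \<in> topspace K \<Longrightarrow> 0 \<le> h n x"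
    and sums: "\<And>x. x \<in> topspace K \<Longrightarrow> (\<lambda>n. h n x) sums s x"
  shows "(\<lambda>n. I (h n)) sums I s"
proof -
  let ?u = "\<lambda>n x. s x - (\<Sum>i<n. h i x)"
  have csum: "continuous_map K euclideanreal (\<lambda>x. \<Sum>i<n. h i x)" for n
    using cont by (intro continuous_map_sum) simp_all
  have "(\<lambda>n. I (?u n)) \<longlonglongrightarrow> 0"
  proof (rule tendsto_zero_of_decreasing)
    show "continuous_map K euclideanreal (?u n)" for n
      using cont csum by (intro continuous_map_diff)
    show "decseq (\<lambda>n. ?u n x)" if "x \<in> topspace K" for x
      using pos[OF that] by (intro decseq_SucI) simp
    show "(\<lambda>n. ?u n x) \<longlonglongrightarrow> 0" if "x \<in> topspace K" for x
      using tendsto_diff[OF tendsto_const sums[OF that, unfolded sums_def], of "s x"] by simp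
  qed
  moreover have "I (?u n) = I s - (\<Sum>i<n. I (h i))" for n
    using diff[OF cont(2) csum] sum[of "{..<n}" h] cont by simp
  ultimately have "(\<lambda>n. I s - (I s - (\<Sum>i<n. I (h i)))) \<longlonglongrightarrow> I s - 0"
    by (intro tendsto_diff tendsto_const) simp
  then show ?thesis by (simp add: sums_def)
qed

section \<open>The measure of the region between two graphs\<close>

definition strip :: "('a \<Rightarrow> real) \<Rightarrow> ('a \<Rightarrow> real) \<Rightarrow> ('a \<times> real) set" where
  "strip f g = {(x, t). x \<in> topspace K \<and> f x < t \<and> t \<le> g x}"

definition strips :: "('a \<times> real) set set" where
  "strips = {strip f g | f g. continuous_map K euclideanreal f \<and> continuous_map K euclideanreal g
     \<and> (\<forall>x\<in>topspace K. f x \<le> g x)}"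

text \<open>
  Different pairs of functions can describe the same strip when their values differ off \<open>K\<close>.
  The fibre lengths depend on the set only, and on \<open>K\<close> they recover \<open>g - f\<close>; the volume
  \<open>I (fibre_length S)\<close> is therefore well defined without a choice of \<open>f\<close> and \<open>g\<close>.
\<close>
definition fibre_length :: "('a \<times> real) set \<Rightarrow> 'a \<Rightarrow> real" where
  "fibre_length S x = measure lborel (Pair x -` S)"

lemma stripsI:
  assumes "continuous_map K euclideanreal f" "continuous_map K euclideanreal g"
    and "\<And>x. x \<in> topspace K \<Longrightarrow> f x \<le> g x"
  shows "strip f g \<in> strips"
  using assms unfolding strips_def by blast

lemma stripsE:
  assumes "S \<in> strips"
  obtains f g where "S = strip f g" "continuous_map K euclideanreal f"
    "continuous_map K euclideanreal g" "\<And>x. x \<in> topspace K \<Longrightarrow> f x \<le> g x"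
  using assms unfolding strips_def by blast

lemma fibre_strip: "x \<in> topspace K \<Longrightarrow> Pair x -` strip f g = {f x<..g x}"
  by (auto simp: strip_def)

lemma fibre_length_strip:
  "x \<in> topspace K \<Longrightarrow> f x \<le> g x \<Longrightarrow> fibre_length (strip f g) x = g x - f x"
  by (simp add: fibre_length_def fibre_strip)

lemma continuous_fibre_length:
  assumes "S \<in> strips"
  shows "continuous_map K euclideanreal (fibre_length S)"
proof -
  obtain f g where S: "S = strip f g" "continuous_map K euclideanreal f"
    "continuous_map K euclideanreal g" "\<And>x. x \<in> topspace K \<Longrightarrow> f x \<le> g x"
    using stripsE[OF assms] by metis
  show ?thesis
    by (rule continuous_cong[OF continuous_map_diff[OF S(3,2)]]) (simp add: S fibre_length_strip)
qed

lemma semiring_strips: "semiring_of_sets (topspace K \<times> UNIV) strips"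
proof
  show "strips \<subseteq> Pow (topspace K \<times> UNIV)"
    by (auto simp: strips_def strip_def)
  have "strip (\<lambda>x. 0) (\<lambda>x. 0) = {}"
    by (auto simp: strip_def)
  then show "{} \<in> strips"
    using stripsI[of "\<lambda>x. 0" "\<lambda>x. 0"] by simp
next
  fix a b assume "a \<in> strips" "b \<in> strips"
  then obtain f g f' g' where
    a: "a = strip f g" "continuous_map K euclideanreal f" "continuous_map K euclideanreal g"
      "\<And>x. x \<in> topspace K \<Longrightarrow> f x \<le> g x" and
    b: "b = strip f' g'" "continuous_map K euclideanreal f'" "continuous_map K euclideanreal g'"
      "\<And>x. x \<in> topspace K \<Longrightarrow> f' x \<le> g' x"
    by (metis stripsE)
  \<comment> \<open>The outer maximum here, like the inner clamps below, only keeps the lower function below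
    the upper one where the strip has an empty fibre.\<close>
  have "a \<inter> b = strip (\<lambda>x. max (f x) (f' x)) (\<lambda>x. max (max (f x) (f' x)) (min (g x) (g' x)))"
    by (auto simp: a b strip_def)
  also have "\<dots> \<in> strips"
    using a b by (intro stripsI continuous_map_real_max continuous_map_real_min) simp_all
  finally show "a \<inter> b \<in> strips" .
  \<comment> \<open>Removing \<open>b\<close> leaves the part of \<open>a\<close> below \<open>f'\<close> and the part above \<open>g'\<close>.\<close>
  let ?below = "strip f (\<lambda>x. max (f x) (min (g x) (f' x)))"
  let ?above = "strip (\<lambda>x. min (g x) (max (f x) (g' x))) g"
  have "?below \<in> strips" "?above \<in> strips"
    using a b by (auto intro!: stripsI continuous_map_real_max continuous_map_real_min)
  moreover have "?below \<inter> ?above = {}"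
    using b(4) by (fastforce simp: strip_def)
  moreover have "a - b = ?below \<union> ?above"
    using b(4) by (fastforce simp: a b strip_def)
  ultimately show "\<exists>C\<subseteq>strips. finite C \<and> disjoint C \<and> a - b = \<Union>C"
    by (intro exI[of _ "{?below, ?above}"]) (auto simp: disjoint_def)
qed

text \<open>
  The only place where compactness of \<open>K\<close> enters the construction of the measure: fibrewise
  additivity of length is turned into additivity of the volume by the lemma \<open>sums\<close>.
\<close>
lemma countably_additive_strips:
  "countably_additive strips (\<lambda>S. ennreal (I (fibre_length S)))"
proof (rule countably_additiveI)
  fix A :: "nat \<Rightarrow> ('a \<times> real) set"
  assume A: "range A \<subseteq> strips" "disjoint_family A" "(\<Union>i. A i) \<in> strips"
  have nn: "0 \<le> fibre_length S x" for S x
    by (simp add: fibre_length_def)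
  have "(\<lambda>i. I (fibre_length (A i))) sums I (fibre_length (\<Union>i. A i))"
  proof (rule sums)
    fix x assume x: "x \<in> topspace K"
    have meas: "Pair x -` S \<in> sets lborel \<and> emeasure lborel (Pair x -` S) \<noteq> \<infinity>" if "S \<in> strips" for S
      using that x by (auto simp: fibre_strip emeasure_lborel_Ioc elim!: stripsE)
    have "(\<lambda>i. measure lborel (Pair x -` A i)) sums measure lborel (\<Union>i. Pair x -` A i)"
    proof (rule measure_UNION)
      show "disjoint_family (\<lambda>i. Pair x -` A i)"
        using A(2) by (fastforce simp: disjoint_family_on_def)
    qed (use meas[OF A(3)] meas A(1) in \<open>auto simp: vimage_UN\<close>)
    then show "(\<lambda>i. fibre_length (A i) x) sums fibre_length (\<Union>i. A i) x"
      by (simp add: fibre_length_def vimage_UN)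
  qed (use A nn in \<open>auto intro!: continuous_fibre_length\<close>)
  moreover have "0 \<le> I (fibre_length (A i))" for i
    using A(1) nn by (intro nonneg continuous_fibre_length) auto
  ultimately show "(\<Sum>i. ennreal (I (fibre_length (A i)))) = ennreal (I (fibre_length (\<Union>i. A i)))"
    by (rule suminf_ennreal_eq[rotated])
qed

lemma strip_measure_exists:
  obtains N where "space N = topspace K \<times> UNIV" "strips \<subseteq> sets N"
    "\<And>f g. continuous_map K euclideanreal f \<Longrightarrow> continuous_map K euclideanreal g
      \<Longrightarrow> (\<And>x. x \<in> topspace K \<Longrightarrow> f x \<le> g x)
      \<Longrightarrow> emeasure N (strip f g) = ennreal (I (\<lambda>x. g x - f x))"
proof -
  interpret semiring_of_sets "topspace K \<times> UNIV" strips
    by (rule semiring_strips)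
  let ?m = "\<lambda>S. ennreal (I (fibre_length S))"
  have "positive strips ?m"
    using zero by (simp add: positive_def fibre_length_def[abs_def])
  then obtain \<nu> where \<nu>: "\<And>S. S \<in> strips \<Longrightarrow> \<nu> S = ?m S"
    "measure_space (topspace K \<times> UNIV) (sigma_sets (topspace K \<times> UNIV) strips) \<nu>"
    using caratheodory[OF _ countably_additive_strips] by blast
  let ?N = "measure_of (topspace K \<times> UNIV) strips \<nu>"
  have sets: "sets ?N = sigma_sets (topspace K \<times> UNIV) strips"
    using space_closed by (rule sets_measure_of)
  show thesis
  proof (rule that[of ?N])
    show "space ?N = topspace K \<times> UNIV"
      using space_closed by (rule space_measure_of)
    show "strips \<subseteq> sets ?N"
      unfolding sets by blast
    fix f g assume fg: "continuous_map K euclideanreal f" "continuous_map K euclideanreal g"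
      "\<And>x. x \<in> topspace K \<Longrightarrow> f x \<le> g x"
    have S: "strip f g \<in> strips" using fg by (rule stripsI)
    have "emeasure ?N (strip f g) = \<nu> (strip f g)"
      by (rule emeasure_measure_of[OF refl space_closed])
        (use \<nu>(2) S sets in \<open>auto simp: measure_space_def\<close>)
    also have "\<dots> = ?m (strip f g)"
      using S by (rule \<nu>(1))
    also have "I (fibre_length (strip f g)) = I (\<lambda>x. g x - f x)"
      using fg S by (intro cong continuous_fibre_length) (simp_all add: fibre_length_strip)
    finally show "emeasure ?N (strip f g) = ennreal (I (\<lambda>x. g x - f x))" .
  qed
qed

section \<open>The Baire measure and its integral\<close>

lemma baire_measurable:
  assumes "baire_measure K \<mu>" "continuous_map K euclideanreal f"
  shows "f \<in> borel_measurable \<mu>"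
proof -
  have "restrict f (topspace K) \<in> cfun K"
    using continuous_cong[OF assms(2)] by (simp add: cfun_def)
  then have "restrict f (topspace K) \<in> borel_measurable \<mu>"
    using assms(1) by (intro cfun_baire_measurable) (auto simp: baire_measure_def)
  then show ?thesis
    by (rule measurable_cong[THEN iffD1, rotated]) (use assms(1) in \<open>simp add: baire_measure_def\<close>)
qed

lemma baire_integrable:
  assumes "baire_measure K \<mu>" "continuous_map K euclideanreal f"
  shows "integrable \<mu> f"
proof -
  have "restrict f (topspace K) \<in> cfun K"
    using continuous_cong[OF assms(2)] by (simp add: cfun_def)
  then have "integrable \<mu> (restrict f (topspace K))"
    using cfun_integrable compact assms(1) by blast
  then show ?thesis
    by (rule Bochner_Integration.integrable_cong[THEN iffD1, rotated -1])
      (use assms(1) in \<open>simp_all add: baire_measure_def\<close>)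
qed

text \<open>
  The functions \<open>max 0 (min 1 (n (f - c)))\<close> increase to the indicator of \<open>{x. c < f x}\<close> and reach
  the value 1 at each point where \<open>c < f\<close>.  This is what makes Baire sets measurable for the
  measure generated by strips.
\<close>
lemma superlevel_cylinder:
  assumes f: "continuous_map K euclideanreal f"
  shows "{x \<in> topspace K. c < f x} \<times> {0<..1}
    = (\<Union>n. strip (\<lambda>x. 0) (\<lambda>x. max 0 (min 1 (real n * (f x - c)))))"
proof -
  have "0 < t \<and> t \<le> 1 \<and> c < f x \<longleftrightarrow> (\<exists>n. 0 < t \<and> t \<le> max 0 (min 1 (real n * (f x - c))))" for x t
  proof (intro iffI; elim exE conjE)
    assume t: "0 < t" "t \<le> 1" and "c < f x"
    then obtain n where "t < real n * (f x - c)"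
      using ex_less_of_nat_mult[of "f x - c" t] by auto
    with t have "t \<le> max 0 (min 1 (real n * (f x - c)))" by simp
    with t show "\<exists>n. 0 < t \<and> t \<le> max 0 (min 1 (real n * (f x - c)))" by blast
  next
    fix n assume t: "0 < t" "t \<le> max 0 (min 1 (real n * (f x - c)))"
    have "real n * (f x - c) \<le> 0" if "\<not> c < f x"
      using that by (intro mult_nonneg_nonpos) simp_all
    with t show "0 < t \<and> t \<le> 1 \<and> c < f x"
      by (auto simp: le_max_iff_disj)
  qed
  then have "(x, t) \<in> {x \<in> topspace K. c < f x} \<times> {0<..1}
      \<longleftrightarrow> (x, t) \<in> (\<Union>n. strip (\<lambda>x. 0) (\<lambda>x. max 0 (min 1 (real n * (f x - c)))))" for x t
    unfolding strip_def mem_Sigma_iff mem_Collect_eq greaterThanAtMost_iff UN_iff prod.case by blast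
  then show ?thesis by (intro set_eqI) (simp only: split_paired_all)
qed

text \<open>
  The two comparisons come from inclusions between \<open>A \<times> {0<..1}\<close> and the strip from 0 to \<open>g\<close>,
  whose measure is \<open>I g\<close>.
\<close>
lemma baire_measure_exists:
  obtains \<mu> where "baire_measure K \<mu>"
    "\<And>g A. continuous_map K euclideanreal g \<Longrightarrow> A \<in> sets \<mu>
      \<Longrightarrow> (\<And>x. x \<in> topspace K \<Longrightarrow> 0 \<le> g x \<and> g x \<le> indicat_real A x) \<Longrightarrow> I g \<le> measure \<mu> A"
    "\<And>g A. continuous_map K euclideanreal g \<Longrightarrow> A \<in> sets \<mu>
      \<Longrightarrow> (\<And>x. x \<in> topspace K \<Longrightarrow> indicat_real A x \<le> g x) \<Longrightarrow> measure \<mu> A \<le> I g"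
proof (rule strip_measure_exists)
  fix N assume N: "space N = topspace K \<times> UNIV" "strips \<subseteq> sets N"
    "\<And>f g. continuous_map K euclideanreal f \<Longrightarrow> continuous_map K euclideanreal g
      \<Longrightarrow> (\<And>x. x \<in> topspace K \<Longrightarrow> f x \<le> g x)
      \<Longrightarrow> emeasure N (strip f g) = ennreal (I (\<lambda>x. g x - f x))"
  let ?S = "topspace K \<times> {0<..1::real}"
  have S: "?S = strip (\<lambda>x. 0) (\<lambda>x. 1)"
    by (auto simp: strip_def)
  have S_sets: "?S \<in> sets N"
    unfolding S using N(2) by (auto intro!: stripsI)
  have space_S: "?S \<inter> space N = ?S"
    by (auto simp: N(1))
  let ?R = "restrict_space N ?S"
  have sets_R: "A \<in> sets ?R \<longleftrightarrow> A \<subseteq> ?S \<and> A \<in> sets N" for A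
    using S_sets space_S by (subst sets_restrict_space_iff) simp_all
  \<comment> \<open>With \<open>topspace K \<times> {0<..1}\<close> as the whole space, the cylinder over a set is its preimage
    under \<open>fst\<close>, so \<open>\<mu>\<close> is an image measure.\<close>
  have meas_fst: "(\<lambda>p. f (fst p)) \<in> borel_measurable ?R" if f: "continuous_map K euclideanreal f" for f
    unfolding borel_measurable_iff_greater
  proof
    fix c
    have "{p \<in> space ?R. c < f (fst p)} = {x \<in> topspace K. c < f x} \<times> {0<..1}"
      by (auto simp: space_restrict_space N(1))
    moreover have "\<dots> \<in> sets N"
      unfolding superlevel_cylinder[OF f]
    proof (intro sets.countable_UN subsetI, clarify)
      fix n
      have "strip (\<lambda>x. 0) (\<lambda>x. max 0 (min 1 (real n * (f x - c)))) \<in> strips"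
        using f by (intro stripsI continuous_map_real_max continuous_map_real_min
            continuous_map_real_mult_left continuous_map_diff) simp_all
      then show "strip (\<lambda>x. 0) (\<lambda>x. max 0 (min 1 (real n * (f x - c)))) \<in> sets N"
        using N(2) by blast
    qed
    ultimately show "{p \<in> space ?R. c < f (fst p)} \<in> sets ?R"
      by (auto simp: sets_R)
  qed
  define B where "B = sigma (topspace K) (baire_sets K)"
  have sets_B: "sets B = baire_sets K" and space_B: "space B = topspace K"
    using sigma_algebra.sets_measure_of_eq[OF sigma_algebra_baire_sets]
      sigma_algebra.space_measure_of_eq[OF sigma_algebra_baire_sets]
    by (simp_all add: B_def)
  have fst_B: "fst \<in> measurable ?R B"
  proof (rule measurable_sigma_sets[OF sets_B[unfolded baire_sets_def]])
    show "fst \<in> space ?R \<rightarrow> topspace K"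
      by (auto simp: space_restrict_space)
    fix y assume "y \<in> {f -` C \<inter> topspace K | f C. f \<in> cfun K \<and> C \<in> sets borel}"
    then obtain f C where y: "y = f -` C \<inter> topspace K" "f \<in> cfun K" "C \<in> sets borel" by blast
    have "(\<lambda>p. f (fst p)) -` C \<inter> space ?R \<in> sets ?R"
      using y by (intro measurable_sets[OF meas_fst]) (simp_all add: cfun_def)
    also have "(\<lambda>p. f (fst p)) -` C \<inter> space ?R = fst -` y \<inter> space ?R"
      by (auto simp: y space_restrict_space)
    finally show "fst -` y \<inter> space ?R \<in> sets ?R" .
  qed blast
  define \<mu> where "\<mu> = distr ?R B fst"
  have sets_\<mu>: "sets \<mu> = baire_sets K" and space_\<mu>: "space \<mu> = topspace K"
    by (simp_all add: \<mu>_def sets_B space_B)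
  have cyl: "A \<times> {0<..1} \<in> sets N \<and> emeasure \<mu> A = emeasure N (A \<times> {0<..1})" if "A \<in> sets \<mu>" for A
  proof -
    have A: "A \<in> sets B" using that by (simp add: \<mu>_def)
    then have "A \<subseteq> topspace K"
      using sets.sets_into_space[of A B] space_B by simp
    then have eq: "fst -` A \<inter> space ?R = A \<times> {0<..1}"
      by (auto simp: space_restrict_space N(1))
    have "A \<times> {0<..1} \<in> sets ?R"
      using measurable_sets[OF fst_B A] unfolding eq .
    then have "A \<times> {0<..1} \<subseteq> ?S" "A \<times> {0<..1} \<in> sets N"
      by (simp_all only: sets_R)
    moreover have "emeasure \<mu> A = emeasure ?R (A \<times> {0<..1})"
      unfolding \<mu>_def by (simp only: emeasure_distr[OF fst_B A] eq)
    ultimately show ?thesis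
      using S_sets space_S by (simp add: emeasure_restrict_space)
  qed
  have "space \<mu> \<in> sets \<mu>" by (rule sets.top)
  then have "emeasure \<mu> (space \<mu>) = ennreal (I (\<lambda>x. 1))"
    using cyl[of "space \<mu>"] N(3)[of "\<lambda>x. 0" "\<lambda>x. 1"] by (simp add: space_\<mu> S)
  then interpret finite_measure \<mu>
    by (intro finite_measureI) simp
  have N0: "emeasure N (strip (\<lambda>x. 0) g) = ennreal (I g)" "strip (\<lambda>x. 0) g \<in> sets N" "0 \<le> I g"
    if "continuous_map K euclideanreal g" "\<And>x. x \<in> topspace K \<Longrightarrow> 0 \<le> g x" for g
    using N(3)[of "\<lambda>x. 0" g] N(2) stripsI[of "\<lambda>x. 0" g] nonneg[of g] that by auto
  show thesis
  proof (rule that)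
    show "baire_measure K \<mu>"
      using finite_measure_axioms sets_\<mu> space_\<mu> by (simp add: baire_measure_def)
    fix g A
    assume g: "continuous_map K euclideanreal g" and A: "A \<in> sets \<mu>"
    {
      assume le: "\<And>x. x \<in> topspace K \<Longrightarrow> 0 \<le> g x \<and> g x \<le> indicat_real A x"
      have sub: "strip (\<lambda>x. 0) g \<subseteq> A \<times> {0<..1}"
      proof
        fix p assume "p \<in> strip (\<lambda>x. 0) g"
        then obtain x t where "p = (x, t)" "x \<in> topspace K" "0 < t" "t \<le> g x"
          by (auto simp: strip_def)
        with le[of x] show "p \<in> A \<times> {0<..1}"
          by (cases "x \<in> A") auto
      qed
      have "ennreal (I g) \<le> emeasure \<mu> A"
        using emeasure_mono[OF sub, of N] cyl[OF A] N0(1)[OF g] le by simp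
      then show "I g \<le> measure \<mu> A"
        by (simp add: emeasure_eq_measure)
    next
      assume ge: "\<And>x. x \<in> topspace K \<Longrightarrow> indicat_real A x \<le> g x"
      have g0: "0 \<le> g x" if "x \<in> topspace K" for x
        using ge[OF that] indicator_pos_le[of A x] by (rule order_trans[rotated])
      have sub: "A \<times> {0<..1} \<subseteq> strip (\<lambda>x. 0) g"
      proof
        fix p :: "'a \<times> real" assume "p \<in> A \<times> {0<..1}"
        then obtain x t where "p = (x, t)" "x \<in> A" "0 < t" "t \<le> 1"
          by auto
        with ge[of x] sets.sets_into_space[OF A] show "p \<in> strip (\<lambda>x. 0) g"
          by (auto simp: strip_def space_\<mu>)
      qed
      have "emeasure \<mu> A \<le> ennreal (I g)"
        using emeasure_mono[OF sub, of N] cyl[OF A] N0(1,2)[OF g g0] by simp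
      then show "measure \<mu> A \<le> I g"
        using N0(3)[OF g g0] by (simp add: emeasure_eq_measure)
    }
  qed
qed

end

text \<open>
  The \<open>k\<close>-th summand is the part of the interval from 0 to \<open>y\<close> that falls between \<open>k\<close> and \<open>k + 1\<close>.
\<close>
lemma sum_ramps:
  fixes y :: real
  assumes "0 \<le> y"
  shows "(\<Sum>k<n. max 0 (min 1 (y - real k))) = min (real n) y"
  using assms by (induction n) (auto simp: min_def max_def)

context positive_linear_functional
begin

text \<open>
  Cutting a function into \<open>n\<close> layers bounds \<open>n\<close> times the discrepancy by a constant that does not
  depend on \<open>n\<close>.
\<close>
theorem baire_representation:
  "\<exists>\<mu>. baire_measure K \<mu> \<and> (\<forall>f. continuous_map K euclideanreal f \<longrightarrow> I f = (\<integral>x. f x \<partial>\<mu>))"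
proof (rule baire_measure_exists)
  fix \<mu> assume \<mu>: "baire_measure K \<mu>"
    and below: "\<And>g A. continuous_map K euclideanreal g \<Longrightarrow> A \<in> sets \<mu>
      \<Longrightarrow> (\<And>x. x \<in> topspace K \<Longrightarrow> 0 \<le> g x \<and> g x \<le> indicat_real A x) \<Longrightarrow> I g \<le> measure \<mu> A"
    and above: "\<And>g A. continuous_map K euclideanreal g \<Longrightarrow> A \<in> sets \<mu>
      \<Longrightarrow> (\<And>x. x \<in> topspace K \<Longrightarrow> indicat_real A x \<le> g x) \<Longrightarrow> measure \<mu> A \<le> I g"
  interpret finite_measure \<mu> using \<mu> by (simp add: baire_measure_def)
  have space: "space \<mu> = topspace K" using \<mu> by (simp add: baire_measure_def)
  note int = baire_integrable[OF \<mu>]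
  \<comment> \<open>Both quantities lie between the measures of \<open>{g = 1}\<close> and \<open>{0 < g}\<close>.\<close>
  have error: "\<bar>(\<integral>x. g x \<partial>\<mu>) - I g\<bar> \<le> measure \<mu> {x \<in> space \<mu>. 0 < g x \<and> g x < 1}"
    if g: "continuous_map K euclideanreal g" and g01: "\<And>x. x \<in> topspace K \<Longrightarrow> 0 \<le> g x \<and> g x \<le> 1" for g
  proof -
    let ?P = "{x \<in> space \<mu>. 0 < g x}" and ?Q = "{x \<in> space \<mu>. 1 \<le> g x}"
    have [measurable]: "g \<in> borel_measurable \<mu>"
      using baire_measurable[OF \<mu> g] .
    have sets: "?P \<in> sets \<mu>" "?Q \<in> sets \<mu>" by measurable
    have up: "g x \<le> indicat_real ?P x" and lo: "indicat_real ?Q x \<le> g x" if "x \<in> topspace K" for x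
      using g01[OF that] that by (auto simp: indicator_def space)
    have "I g \<le> measure \<mu> ?P" "measure \<mu> ?Q \<le> I g"
      using below[OF g sets(1)] above[OF g sets(2)] up lo g01 by blast+
    moreover have "(\<integral>x. g x \<partial>\<mu>) \<le> (\<integral>x. indicat_real ?P x \<partial>\<mu>)"
      using up sets(1) by (intro integral_mono int[OF g]) (simp_all add: space less_top[symmetric])
    moreover have "(\<integral>x. indicat_real ?Q x \<partial>\<mu>) \<le> (\<integral>x. g x \<partial>\<mu>)"
      using lo sets(2) by (intro integral_mono int[OF g]) (simp_all add: space less_top[symmetric])
    moreover have "measure \<mu> ?P - measure \<mu> ?Q = measure \<mu> (?P - ?Q)"
      using sets by (intro finite_measure_Diff[symmetric]) auto
    moreover have "?P - ?Q = {x \<in> space \<mu>. 0 < g x \<and> g x < 1}"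
      by auto
    ultimately show ?thesis
      using sets by (simp add: Int_absorb2 sets.sets_into_space)
  qed
  have unit: "I f = (\<integral>x. f x \<partial>\<mu>)"
    if f: "continuous_map K euclideanreal f" and f01: "\<And>x. x \<in> topspace K \<Longrightarrow> 0 \<le> f x \<and> f x \<le> 1" for f
  proof -
    have bound: "real n * \<bar>(\<integral>x. f x \<partial>\<mu>) - I f\<bar> \<le> measure \<mu> (space \<mu>)" for n
    proof -
      define g where "g k x = max 0 (min 1 (real n * f x - real k))" for k x
      define D where "D k = {x \<in> space \<mu>. 0 < g k x \<and> g k x < 1}" for k
      have g: "continuous_map K euclideanreal (g k)" for k
        unfolding g_def using f
        by (intro continuous_map_real_max continuous_map_real_min continuous_map_real_mult_left
            continuous_map_diff) simp_all
      have g_sum: "(\<Sum>k<n. g k x) = real n * f x" if "x \<in> topspace K" for x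
        using sum_ramps[of "real n * f x" n] f01[OF that] mult_left_le[of "f x" "real n"]
        by (simp add: g_def min_absorb2)
      have "real n * (\<integral>x. f x \<partial>\<mu>) = (\<integral>x. (\<Sum>k<n. g k x) \<partial>\<mu>)"
        unfolding integral_mult_right_zero[symmetric]
        using g_sum by (intro Bochner_Integration.integral_cong) (simp_all add: space)
      also have "\<dots> = (\<Sum>k<n. \<integral>x. g k x \<partial>\<mu>)"
        using int[OF g] by (intro Bochner_Integration.integral_sum)
      finally have int_sum: "real n * (\<integral>x. f x \<partial>\<mu>) = (\<Sum>k<n. \<integral>x. g k x \<partial>\<mu>)" .
      have "real n * I f = I (\<lambda>x. \<Sum>k<n. g k x)"
        unfolding cmult[OF f, symmetric]
        using g_sum f by (intro cong continuous_map_real_mult_left) simp_all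
      then have I_sum: "real n * I f = (\<Sum>k<n. I (g k))"
        using sum[of "{..<n}" g] g by simp
      have [measurable]: "g k \<in> borel_measurable \<mu>" for k
        using baire_measurable[OF \<mu> g] .
      have D_sets: "D k \<in> sets \<mu>" for k
        unfolding D_def by measurable
      \<comment> \<open>\<open>D k\<close> is the set where \<open>n f\<close> lies strictly between \<open>k\<close> and \<open>k + 1\<close>.\<close>
      have D_disj: "disjoint_family_on D {..<n}"
        by (auto simp: disjoint_family_on_def D_def g_def max_def min_def split: if_splits)
      have "real n * \<bar>(\<integral>x. f x \<partial>\<mu>) - I f\<bar> = \<bar>\<Sum>k<n. (\<integral>x. g k x \<partial>\<mu>) - I (g k)\<bar>"
        unfolding sum_subtractf int_sum[symmetric] I_sum[symmetric] right_diff_distrib[symmetric]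
        by (simp add: abs_mult)
      also have "\<dots> \<le> (\<Sum>k<n. \<bar>(\<integral>x. g k x \<partial>\<mu>) - I (g k)\<bar>)"
        by (rule sum_abs)
      also have "\<dots> \<le> (\<Sum>k<n. measure \<mu> (D k))"
        unfolding D_def by (intro sum_mono error g) (simp add: g_def)
      also have "\<dots> = measure \<mu> (\<Union>k<n. D k)"
        using D_sets D_disj by (intro finite_measure_finite_Union[symmetric]) auto
      also have "\<dots> \<le> measure \<mu> (space \<mu>)"
        by (rule bounded_measure)
      finally show ?thesis .
    qed
    have "\<bar>(\<integral>x. f x \<partial>\<mu>) - I f\<bar> = 0"
    proof (rule ccontr)
      assume "\<bar>(\<integral>x. f x \<partial>\<mu>) - I f\<bar> \<noteq> 0"
      then obtain n where "measure \<mu> (space \<mu>) < real n * \<bar>(\<integral>x. f x \<partial>\<mu>) - I f\<bar>"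
        using ex_less_of_nat_mult[of "\<bar>(\<integral>x. f x \<partial>\<mu>) - I f\<bar>"] by auto
      with bound[of n] show False by simp
    qed
    then show ?thesis by simp
  qed
  have "I f = (\<integral>x. f x \<partial>\<mu>)" if f: "continuous_map K euclideanreal f" for f
  proof -
    have "compactin euclideanreal (f ` topspace K)"
      using image_compactin[OF _ f] compact by (simp add: compact_space_def)
    then have "bounded (f ` topspace K)"
      by (simp add: compact_imp_bounded)
    then obtain b where b: "0 < b" "\<And>x. x \<in> topspace K \<Longrightarrow> \<bar>f x\<bar> \<le> b"
      by (auto simp: bounded_pos)
    \<comment> \<open>A bounded function is an affine image of one with values between 0 and 1.\<close>
    define h where "h x = (1 / (2 * b)) * (f x + b)" for x
    have h: "continuous_map K euclideanreal h"
      unfolding h_def using f by (intro continuous_map_real_mult_left continuous_map_add) simp_all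
    have f_h: "f = (\<lambda>x. 2 * b * h x - b)"
      using b(1) by (auto simp: h_def)
    have "I h = (\<integral>x. h x \<partial>\<mu>)"
    proof (rule unit[OF h])
      fix x assume "x \<in> topspace K"
      from b(2)[OF this] b(1) show "0 \<le> h x \<and> h x \<le> 1"
        by (auto simp: h_def field_simps abs_le_iff)
    qed
    moreover have "I (\<lambda>x. 1) = (\<integral>x. 1 \<partial>\<mu>)"
      by (rule unit) simp_all
    moreover have "I f = 2 * b * I h - b * I (\<lambda>x. 1)"
      using diff[of "\<lambda>x. 2 * b * h x" "\<lambda>x. b"] cmult[OF h, of "2 * b"] cmult[of "\<lambda>x. 1" b]
        continuous_map_real_mult_left[OF h, of "2 * b"]
      by (subst f_h) simp
    moreover have "(\<integral>x. f x \<partial>\<mu>) = 2 * b * (\<integral>x. h x \<partial>\<mu>) - b * (\<integral>x. 1 \<partial>\<mu>)"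
      by (subst f_h, subst Bochner_Integration.integral_diff) (use int[OF h] in simp_all)
    ultimately show ?thesis by simp
  qed
  with \<mu> show ?thesis by blast
qed

end

theorem theorem2p2:
  fixes K :: "'a topology" and \<xi> :: "('a \<Rightarrow> real) \<Rightarrow> real"
  assumes "compact_space K" and "Hausdorff_space K"
    and "linear_functional K \<xi>" and "positive_functional K \<xi>"
  shows "\<exists>\<mu>. baire_measure K \<mu> \<and> (\<forall>f\<in>cfun K. \<xi> f = (\<integral>x. f x \<partial>\<mu>))"
proof -
  let ?r = "\<lambda>f. restrict f (topspace K)"
  have r: "?r f \<in> cfun K" if "continuous_map K euclideanreal f" for f
    using continuous_map_eq[OF that, of "?r f"] by (simp add: cfun_def)
  interpret positive_linear_functional K "\<lambda>f. \<xi> (?r f)"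
  proof
    show "compact_space K" by fact
  next
    fix f g assume fg: "continuous_map K euclideanreal f" "continuous_map K euclideanreal g"
    have "?r (\<lambda>x. f x + g x) = (\<lambda>x\<in>topspace K. ?r f x + ?r g x)" by auto
    then show "\<xi> (?r (\<lambda>x. f x + g x)) = \<xi> (?r f) + \<xi> (?r g)"
      using assms(3) r[OF fg(1)] r[OF fg(2)] by (simp only: linear_functional_def)
  next
    fix c f assume f: "continuous_map K euclideanreal f"
    have "?r (\<lambda>x. c * f x) = (\<lambda>x\<in>topspace K. c * ?r f x)" by auto
    then show "\<xi> (?r (\<lambda>x. c * f x)) = c * \<xi> (?r f)"
      using assms(3) r[OF f] by (simp only: linear_functional_def)
  next
    fix f assume "continuous_map K euclideanreal f" "\<And>x. x \<in> topspace K \<Longrightarrow> 0 \<le> f x"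
    then show "0 \<le> \<xi> (?r f)"
      using assms(4) r[of f] by (simp add: positive_functional_def)
  qed
  show ?thesis
    using baire_representation by (simp add: cfun_def) (metis extensional_restrict)
qed

end
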